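(* Let $g:\mathbb{R}^n\to\mathbb{R}$ be strongly convex, let $F:2^{[n]}\to\mathbb{R}$ be submodular with $F(\emptyset)=0$, and let $\epsilon\ge 0$. For any run of the algorithm L-KM on $(g,F,\epsilon)$ and for every $i\ge 0$ for which the memory set $\mathcal{V}^{(i)}$ is defined, the vectors in $\mathcal{V}^{(i)}$ are affinely independent. Moreover, $|\mathcal{V}^{(i)}|\le n+1$.
   Context: $[n]=\{1,\dots,n\}$. $F:2^{[n]}\to\mathbb{R}$ is submodular if $F(A)+F(B)\ge F(A\cup B)+F(A\cap B)$ for all $A,B\subseteq[n]$. For $w\in\mathbb{R}^n$ put $w(A)=\sum_{k\in A}w_k$. The base polytope is $B(F)=\{w\in\mathbb{R}^n: w(A)\le F(A)\ \forall A\subseteq[n],\ w([n])=F([n])\}$, with vertex set $\mathrm{vert}(B(F))$. The Lovász extension is $f(x)=\max_{w\in B(F)}w^\top x$. A function $g$ is $\alpha$-strongly convex ($\alpha>0$) if $g-\frac{\alpha}{2}\|\cdot\|_2^2$ is convex; strongly convex means this for some $\alpha>0$. Algorithm L-KM (Limited Memory Kelley's Method) for minimizing $g+f$ over $\mathbb{R}^n$ with tolerance $\epsilon\ge 0$: choose a nonempty affinely independent set $\mathcal{V}^{(0)}\subseteq\mathrm{vert}(B(F))$. For $i=1,2,\dots$: (1) let $f_{(i)}(x)=\max\{w^\top x: w\in\mathcal{V}^{(i-1)}\}$ and let $x^{(i)}$ be the (unique) minimizer of $g+f_{(i)}$ over $\mathbb{R}^n$; (2) choose a vertex $v^{(i)}\in\mathrm{vert}(B(F))$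 with $v^{(i)}\in\operatorname{argmax}_{w\in B(F)}w^\top x^{(i)}$, so $f(x^{(i)})=(v^{(i)})^\top x^{(i)}$; (3) let $p^{(i)}=g(x^{(i)})+f(x^{(i)})$, $d^{(i)}=g(x^{(i)})+f_{(i)}(x^{(i)})$; stop and return $x^{(i)}$ if $p^{(i)}-d^{(i)}\le\epsilon$; (4) otherwise let $\mathcal{A}^{(i)}=\{w\in\mathcal{V}^{(i-1)}: w^\top x^{(i)}=f_{(i)}(x^{(i)})\}$ and $\mathcal{V}^{(i)}=\mathcal{A}^{(i)}\cup\{v^{(i)}\}$. *)

theory Defs
  imports "HOL-Analysis.Analysis"
begin

text \<open>The ground set \<open>[n]\<close> is the finite index type \<open>'n\<close>, so \<open>n = CARD('n)\<close>.\<close>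

definition submodular :: "('n::finite set \<Rightarrow> real) \<Rightarrow> bool" where
  "submodular F \<longleftrightarrow> (\<forall>A B. F A + F B \<ge> F (A \<union> B) + F (A \<inter> B))"

definition base_polytope :: "('n::finite set \<Rightarrow> real) \<Rightarrow> (real^'n) set" where
  "base_polytope F =
     {w. (\<forall>A. (\<Sum>k\<in>A. w $ k) \<le> F A) \<and> (\<Sum>k\<in>UNIV. w $ k) = F UNIV}"

definition vert :: "(real^'n::finite) set \<Rightarrow> (real^'n) set" where
  "vert P = {w. w extreme_point_of P}"

text \<open>For submodular \<open>F\<close> with \<open>F {} = 0\<close> the base polytope is nonempty and compact, so the
  supremum is a maximum; see \<open>lovasz_extension_eq_maximum\<close>.\<close>

definition lovasz_extension :: "('n::finite set \<Rightarrow> real) \<Rightarrow> real^'n \<Rightarrow> real" where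
  "lovasz_extension F x = (SUP w\<in>base_polytope F. w \<bullet> x)"

lemma lovasz_extension_eq_maximum:
  assumes "is_arg_max (\<lambda>w. w \<bullet> x) (\<lambda>w. w \<in> base_polytope F) v"
  shows "lovasz_extension F x = v \<bullet> x"
  unfolding lovasz_extension_def
  by (rule cSup_eq_maximum) (use assms in \<open>auto simp: is_arg_max_linorder\<close>)

definition strongly_convex :: "(real^'n::finite \<Rightarrow> real) \<Rightarrow> bool" where
  "strongly_convex g \<longleftrightarrow> (\<exists>\<alpha>>0. convex_on UNIV (\<lambda>x. g x - \<alpha> / 2 * (norm x)\<^sup>2))"

text \<open>The piecewise linear model \<open>f\<^sub>(\<^sub>i\<^sub>)\<close> built from a memory set. Memory sets are finite and
  nonempty (the initial one is affinely independent, later ones add one vector to a subset of the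
  previous one), so \<open>Max\<close> is a genuine maximum.\<close>

definition lkm_model :: "(real^'n::finite) set \<Rightarrow> real^'n \<Rightarrow> real" where
  "lkm_model W x = Max ((\<lambda>w. w \<bullet> x) ` W)"

definition lkm_active :: "(real^'n::finite) set \<Rightarrow> real^'n \<Rightarrow> (real^'n) set" where
  "lkm_active W x = {w \<in> W. w \<bullet> x = lkm_model W x}"

definition lkm_init :: "('n::finite set \<Rightarrow> real) \<Rightarrow> (real^'n) set \<Rightarrow> bool" where
  "lkm_init F W \<longleftrightarrow>
     W \<noteq> {} \<and> W \<subseteq> vert (base_polytope F) \<and> \<not> affine_dependent W"

text \<open>Steps (1) and (2) of an iteration with memory set \<open>W\<close>, and the stopping test (3).\<close>

definition lkm_choice ::
  "(real^'n::finite \<Rightarrow> real) \<Rightarrow> ('n set \<Rightarrow> real) \<Rightarrow> (real^'n) set \<Rightarrow> real^'n \<Rightarrow> real^'n \<Rightarrow> bool"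
where
  "lkm_choice g F W x v \<longleftrightarrow>
     is_arg_min (\<lambda>y. g y + lkm_model W y) (\<lambda>_. True) x \<and>
     v \<in> vert (base_polytope F) \<and>
     is_arg_max (\<lambda>w. w \<bullet> x) (\<lambda>w. w \<in> base_polytope F) v"

definition lkm_stop ::
  "(real^'n::finite \<Rightarrow> real) \<Rightarrow> ('n set \<Rightarrow> real) \<Rightarrow> real \<Rightarrow> (real^'n) set \<Rightarrow> real^'n \<Rightarrow> bool"
where
  "lkm_stop g F \<epsilon> W x \<longleftrightarrow>
     (g x + lovasz_extension F x) - (g x + lkm_model W x) \<le> \<epsilon>"

text \<open>\<open>N\<close> is the number of iterations of the run: the run stops in iteration \<open>N\<close>, or never if
  \<open>N = \<infinity>\<close>. The point \<open>x i\<close> and the vertex \<open>v i\<close> are meaningful for \<open>1 \<le> i \<le> N\<close>. Since the last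
  iteration does not produce a new memory set, \<open>V i\<close> is meaningful exactly for \<open>i < N\<close>.\<close>

definition lkm_run ::
  "(real^'n::finite \<Rightarrow> real) \<Rightarrow> ('n set \<Rightarrow> real) \<Rightarrow> real \<Rightarrow> enat \<Rightarrow>
   (nat \<Rightarrow> (real^'n) set) \<Rightarrow> (nat \<Rightarrow> real^'n) \<Rightarrow> (nat \<Rightarrow> real^'n) \<Rightarrow> bool"
where
  "lkm_run g F \<epsilon> N V x v \<longleftrightarrow>
     1 \<le> N \<and> lkm_init F (V 0) \<and>
     (\<forall>i\<ge>1. enat i \<le> N \<longrightarrow>
        lkm_choice g F (V (i - 1)) (x i) (v i) \<and>
        (lkm_stop g F \<epsilon> (V (i - 1)) (x i) \<longleftrightarrow> enat i = N)) \<and>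
     (\<forall>i\<ge>1. enat i < N \<longrightarrow> V i = lkm_active (V (i - 1)) (x i) \<union> {v i})"

end

theory Submission
  imports Defs
begin

text \<open>The active vectors lie on the hyperplane \<open>w \<bullet> x = f\<^sub>(\<^sub>i\<^sub>)(x)\<close>, hence so does their affine hull. When the
  stopping test fails, the new vertex satisfies \<open>v \<bullet> x = f(x) > f\<^sub>(\<^sub>i\<^sub>)(x)\<close>, so it lies off that
  hyperplane and adding it keeps affine independence.\<close>

lemma affine_independent_insert_off_hyperplane:
  fixes A :: "'a::euclidean_space set"
  assumes "\<not> affine_dependent A" and "\<And>w. w \<in> A \<Longrightarrow> w \<bullet> x = c" and "v \<bullet> x \<noteq> c"
  shows "\<not> affine_dependent (insert v A)"
proof -
  have "affine hull A \<subseteq> {w. x \<bullet> w = c}"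
    using assms(2) by (intro hull_minimal affine_hyperplane) (auto simp: inner_commute)
  then have "v \<notin> affine hull A"
    using assms(3) by (auto simp: inner_commute)
  with assms(1) show ?thesis
    by (rule affine_independent_insert)
qed

text \<open>Discarding the inactive vectors passes to a subset, which stays affinely independent;
  this is the inductive step for the memory sets.\<close>

lemma lkm_step_affine_independent:
  assumes "\<not> affine_dependent W" and "lkm_choice g F W x v"
    and "\<not> lkm_stop g F \<epsilon> W x" and "\<epsilon> \<ge> 0"
  shows "\<not> affine_dependent (insert v (lkm_active W x))"
proof (rule affine_independent_insert_off_hyperplane)
  show "\<not> affine_dependent (lkm_active W x)"
    using assms(1) by (rule affine_independent_subset) (auto simp: lkm_active_def)
  show "w \<bullet> x = lkm_model W x" if "w \<in> lkm_active W x" for w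
    using that by (simp add: lkm_active_def)
  have "lovasz_extension F x = v \<bullet> x"
    using assms(2) unfolding lkm_choice_def by (blast intro: lovasz_extension_eq_maximum)
  \<comment> \<open>The terms \<open>g x\<close> cancel in the stopping test, so its failure reads
    \<open>v \<bullet> x - lkm_model W x > \<epsilon>\<close>, and \<open>\<epsilon> \<ge> 0\<close>
    makes this gap positive.\<close>
  then show "v \<bullet> x \<noteq> lkm_model W x"
    using assms(3,4) by (simp add: lkm_stop_def)
qed

lemma lkm_run_affine_independent:
  assumes "lkm_run g F \<epsilon> N V x v" and "\<epsilon> \<ge> 0" and "enat i < N"
  shows "\<not> affine_dependent (V i)"
  using assms(3)
proof (induction i)
  case 0
  then show ?case
    using assms(1) by (simp add: lkm_run_def lkm_init_def)
next
  case (Suc i)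
  have "enat i < N"
    using Suc.prems by (meson enat_ord_simps(2) lessI less_trans)
  then have "\<not> affine_dependent (V i)"
    by (rule Suc.IH)
  \<comment> \<open>Iteration \<open>Suc i\<close> works on \<open>V i\<close>. As
    \<open>enat (Suc i) < N\<close> is strict, it is not the last iteration, so its stopping test
    fails.\<close>
  moreover have "lkm_choice g F (V i) (x (Suc i)) (v (Suc i))"
    and "\<not> lkm_stop g F \<epsilon> (V i) (x (Suc i))"
    and "V (Suc i) = insert (v (Suc i)) (lkm_active (V i) (x (Suc i)))"
    using assms(1) Suc.prems unfolding lkm_run_def
    by (metis One_nat_def Suc_le_mono diff_Suc_1 less_imp_le less_irrefl zero_le Un_insert_right sup_bot_right)+
  ultimately show ?case
    using assms(2) lkm_step_affine_independent by metis
qed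

theorem theorem3p1:
  fixes g :: "real^'n::finite \<Rightarrow> real"
    and F :: "'n set \<Rightarrow> real"
    and \<epsilon> :: real
    and N :: enat
    and V :: "nat \<Rightarrow> (real^'n) set"
    and x v :: "nat \<Rightarrow> real^'n"
    and i :: nat
  assumes "strongly_convex g"
    and "submodular F"
    and "F {} = 0"
    and "\<epsilon> \<ge> 0"
    and "lkm_run g F \<epsilon> N V x v"
    and "enat i < N"
  shows "\<not> affine_dependent (V i) \<and> finite (V i) \<and> card (V i) \<le> CARD('n) + 1"
proof -
  have indep: "\<not> affine_dependent (V i)"
    using assms(4-6) by (intro lkm_run_affine_independent)
  have "finite (V i)"
    using indep by (rule aff_independent_finite)
  moreover have "card (V i) \<le> CARD('n) + 1"
  proof (rule ccontr)
    assume "\<not> card (V i) \<le> CARD('n) + 1"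
    \<comment> \<open>Otherwise there are at least \<open>CARD('n) + 2\<close> vectors, two more
      than the dimension of \<open>real^'n\<close>, which forces affine dependence.\<close>
    then show False
      using affine_dependent_biggerset[of "V i"] indep \<open>finite (V i)\<close> by simp
  qed
  ultimately show ?thesis
    using indep by blast
qed

end
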